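(* Let $a,b$ be nonzero real numbers and let $\widetilde{Q}_n=Q_n+\varepsilon Q_{n+1}$ be the bi-periodic dual Fibonacci quaternions. Then the generating function $G(t)=\sum_{n=0}^{\infty}\widetilde{Q}_n t^n$ is $$G(t)=\frac{Q_0+(Q_1-bQ_0)t+(a-b)R(t)}{1-bt-t^2}+\varepsilon\left(\frac{Q_1+(Q_2-bQ_1)t+(a-b)S(t)}{1-bt-t^2}\right),$$ where $$R(t)=tf(t)+(f(t)-t)\,i+\left(\frac{f(t)}{t}-1\right)j+\left(\frac{f(t)}{t^2}-\frac1t-(ab+1)t\right)k,$$ $$S(t)=(f(t)-t)+\left(\frac{f(t)}{t}-1\right)i+\left(\frac{f(t)}{t^2}-\frac1t-(ab+1)t\right)j+\left(\frac{f(t)}{t^3}-\frac1{t^2}-(ab+1)\right)k,$$ and $f(t)=\sum_{m=1}^{\infty}F_{2m-1}t^{2m-1}$.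
   Context: For nonzero real numbers $a,b$, the bi-periodic Fibonacci numbers are defined by $F_0=0$, $F_1=1$ and, for $n\ge 2$, $F_n=aF_{n-1}+F_{n-2}$ if $n$ is even, $F_n=bF_{n-1}+F_{n-2}$ if $n$ is odd. The bi-periodic Fibonacci quaternions are $Q_n=F_n+F_{n+1}i+F_{n+2}j+F_{n+3}k$, where $i,j,k$ are the quaternion units: $i^2=j^2=k^2=ijk=-1$. The dual unit $\varepsilon\neq 0$ satisfies $\varepsilon^2=0$ and commutes with quaternions; a dual quaternion is an expression $q+\varepsilon q^{\ast}$ with $q,q^{\ast}$ quaternions. The bi-periodic dual Fibonacci quaternions are $\widetilde{Q}_n=Q_n+\varepsilon Q_{n+1}$. The identity is one of formal power series in a central variable $t$ (the negative powers of $t$ occurring in $R$ and $S$ cancel). *)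

theory Defs
  imports Complex_Main "HOL-Computational_Algebra.Formal_Laurent_Series"
begin

section \<open>Quaternions\<close>

codatatype quat = Quat (qRe: real) (qIm1: real) (qIm2: real) (qIm3: real)

lemma quat_eq_iff: "x = y \<longleftrightarrow> qRe x = qRe y \<and> qIm1 x = qIm1 y \<and> qIm2 x = qIm2 y \<and> qIm3 x = qIm3 y"
  using quat.expand by auto

instantiation quat :: real_vector
begin

primcorec zero_quat where
  "qRe 0 = 0" | "qIm1 0 = 0" | "qIm2 0 = 0" | "qIm3 0 = 0"

primcorec plus_quat where
  "qRe (x + y) = qRe x + qRe y"
| "qIm1 (x + y) = qIm1 x + qIm1 y"
| "qIm2 (x + y) = qIm2 x + qIm2 y"
| "qIm3 (x + y) = qIm3 x + qIm3 y"

primcorec uminus_quat where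
  "qRe (- x) = - qRe x"
| "qIm1 (- x) = - qIm1 x"
| "qIm2 (- x) = - qIm2 x"
| "qIm3 (- x) = - qIm3 x"

primcorec minus_quat where
  "qRe (x - y) = qRe x - qRe y"
| "qIm1 (x - y) = qIm1 x - qIm1 y"
| "qIm2 (x - y) = qIm2 x - qIm2 y"
| "qIm3 (x - y) = qIm3 x - qIm3 y"

primcorec scaleR_quat where
  "qRe (r *\<^sub>R x) = r * qRe x"
| "qIm1 (r *\<^sub>R x) = r * qIm1 x"
| "qIm2 (r *\<^sub>R x) = r * qIm2 x"
| "qIm3 (r *\<^sub>R x) = r * qIm3 x"

instance
  by standard (simp_all add: quat_eq_iff algebra_simps)

end

instantiation quat :: real_div_algebra
begin

primcorec one_quat where
  "qRe 1 = 1" | "qIm1 1 = 0" | "qIm2 1 = 0" | "qIm3 1 = 0"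

primcorec times_quat where
  "qRe (x * y) = qRe x * qRe y - qIm1 x * qIm1 y - qIm2 x * qIm2 y - qIm3 x * qIm3 y"
| "qIm1 (x * y) = qRe x * qIm1 y + qIm1 x * qRe y + qIm2 x * qIm3 y - qIm3 x * qIm2 y"
| "qIm2 (x * y) = qRe x * qIm2 y - qIm1 x * qIm3 y + qIm2 x * qRe y + qIm3 x * qIm1 y"
| "qIm3 (x * y) = qRe x * qIm3 y + qIm1 x * qIm2 y - qIm2 x * qIm1 y + qIm3 x * qRe y"

primcorec inverse_quat where
  "qRe (inverse x) = qRe x / ((qRe x)\<^sup>2 + (qIm1 x)\<^sup>2 + (qIm2 x)\<^sup>2 + (qIm3 x)\<^sup>2)"
| "qIm1 (inverse x) = - qIm1 x / ((qRe x)\<^sup>2 + (qIm1 x)\<^sup>2 + (qIm2 x)\<^sup>2 + (qIm3 x)\<^sup>2)"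
| "qIm2 (inverse x) = - qIm2 x / ((qRe x)\<^sup>2 + (qIm1 x)\<^sup>2 + (qIm2 x)\<^sup>2 + (qIm3 x)\<^sup>2)"
| "qIm3 (inverse x) = - qIm3 x / ((qRe x)\<^sup>2 + (qIm1 x)\<^sup>2 + (qIm2 x)\<^sup>2 + (qIm3 x)\<^sup>2)"

definition "x div y = x * inverse y" for x y :: quat

instance
proof
  fix x :: quat
  assume "x \<noteq> 0"
  let ?N = "(qRe x)\<^sup>2 + (qIm1 x)\<^sup>2 + (qIm2 x)\<^sup>2 + (qIm3 x)\<^sup>2"
  have N: "?N \<noteq> 0"
  proof
    assume "?N = 0"
    moreover have "(qRe x)\<^sup>2 \<ge> 0" "(qIm1 x)\<^sup>2 \<ge> 0" "(qIm2 x)\<^sup>2 \<ge> 0" "(qIm3 x)\<^sup>2 \<ge> 0"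
      by simp_all
    ultimately have "(qRe x)\<^sup>2 = 0" "(qIm1 x)\<^sup>2 = 0" "(qIm2 x)\<^sup>2 = 0" "(qIm3 x)\<^sup>2 = 0"
      by linarith+
    with \<open>x \<noteq> 0\<close> show False
      by (simp add: quat_eq_iff)
  qed
  have d: "u / ?N * v = u * v / ?N" "v * (u / ?N) = v * u / ?N" for u v
    by simp_all
  show "inverse x * x = 1"
    using N
    by (simp only: quat_eq_iff times_quat.simps inverse_quat.simps one_quat.simps d
          add_divide_distrib[symmetric] diff_divide_distrib[symmetric])
       (simp add: power2_eq_square algebra_simps)
  show "x * inverse x = 1"
    using N
    by (simp only: quat_eq_iff times_quat.simps inverse_quat.simps one_quat.simps d
          add_divide_distrib[symmetric] diff_divide_distrib[symmetric])
       (simp add: power2_eq_square algebra_simps)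
qed (simp_all add: quat_eq_iff algebra_simps divide_quat_def)

end

definition quat_i :: quat where "quat_i = Quat 0 1 0 0"
definition quat_j :: quat where "quat_j = Quat 0 0 1 0"
definition quat_k :: quat where "quat_k = Quat 0 0 0 1"

lemma quat_unit_rules:
  "quat_i * quat_i = -1" "quat_j * quat_j = -1" "quat_k * quat_k = -1" "quat_i * quat_j * quat_k = -1"
  by (simp_all add: quat_eq_iff quat_i_def quat_j_def quat_k_def)


section \<open>Dual numbers over a ring\<close>

codatatype 'a dual = Dual (std_part: 'a) (dual_part: 'a)

lemma dual_eq_iff: "x = y \<longleftrightarrow> std_part x = std_part y \<and> dual_part x = dual_part y"
  using dual.expand by auto

instantiation dual :: (ring_1) ring_1
begin

primcorec zero_dual where "std_part 0 = 0" | "dual_part 0 = 0"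
primcorec one_dual where "std_part 1 = 1" | "dual_part 1 = 0"
primcorec plus_dual where "std_part (x + y) = std_part x + std_part y" | "dual_part (x + y) = dual_part x + dual_part y"
primcorec uminus_dual where "std_part (- x) = - std_part x" | "dual_part (- x) = - dual_part x"
primcorec minus_dual where "std_part (x - y) = std_part x - std_part y" | "dual_part (x - y) = dual_part x - dual_part y"
primcorec times_dual where
  "std_part (x * y) = std_part x * std_part y"
| "dual_part (x * y) = std_part x * dual_part y + dual_part x * std_part y"

instance
  by standard (simp_all add: dual_eq_iff algebra_simps)

end

definition dual_of :: "'a::ring_1 \<Rightarrow> 'a dual" where
  "dual_of q = Dual q 0"

definition dual_unit :: "'a::ring_1 dual" ("\<epsilon>") where
  "\<epsilon> = Dual 0 1"

lemma dual_unit_rules: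
  "\<epsilon> \<noteq> (0 :: 'a::ring_1 dual)"
  "\<epsilon> * \<epsilon> = (0 :: 'a dual)"
  "\<epsilon> * dual_of q = dual_of q * \<epsilon>"
  "Dual q q' = dual_of q + \<epsilon> * dual_of q'"
  by (simp_all add: dual_eq_iff dual_unit_def dual_of_def)

lift_definition fls_dual_of :: "'a::ring_1 fls \<Rightarrow> 'a dual fls"
  is "\<lambda>f n. dual_of (f n)"
  by (erule MOST_mono) (simp add: dual_of_def dual_eq_iff)


section \<open>Bi-periodic dual Fibonacci quaternions\<close>

fun bifib :: "real \<Rightarrow> real \<Rightarrow> nat \<Rightarrow> real" where
  "bifib a b 0 = 0"
| "bifib a b (Suc 0) = 1"
| "bifib a b (Suc (Suc n)) =
     (if even (Suc (Suc n)) then a else b) * bifib a b (Suc n) + bifib a b n"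

definition bifib_quat :: "real \<Rightarrow> real \<Rightarrow> nat \<Rightarrow> quat" where
  "bifib_quat a b n = of_real (bifib a b n) + of_real (bifib a b (n + 1)) * quat_i
     + of_real (bifib a b (n + 2)) * quat_j + of_real (bifib a b (n + 3)) * quat_k"

definition bifib_dual_quat :: "real \<Rightarrow> real \<Rightarrow> nat \<Rightarrow> quat dual" where
  "bifib_dual_quat a b n = dual_of (bifib_quat a b n) + \<epsilon> * dual_of (bifib_quat a b (n + 1))"

definition bifib_dual_quat_gf :: "real \<Rightarrow> real \<Rightarrow> quat dual fps" where
  "bifib_dual_quat_gf a b = Abs_fps (bifib_dual_quat a b)"

text \<open>
  The series \<open>f\<close>, \<open>R\<close> and \<open>S\<close> are taken as Laurent series over the quaternions, since negative
  powers of the variable occur; these Laurent series form a division ring in which \<open>fls_X\<close>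
  and all series with real coefficients are central.
\<close>

definition bifib_odd_gf :: "real \<Rightarrow> real \<Rightarrow> quat fls" where
  "bifib_odd_gf a b = fps_to_fls (Abs_fps (\<lambda>n. if odd n then of_real (bifib a b n) else 0))"

definition gf_R :: "real \<Rightarrow> real \<Rightarrow> quat fls" where
  "gf_R a b = (let f = bifib_odd_gf a b; t = fls_X; c = fls_const (of_real (a * b + 1)) in
       t * f
     + (f - t) * fls_const quat_i
     + (f / t - 1) * fls_const quat_j
     + (f / t ^ 2 - 1 / t - c * t) * fls_const quat_k)"

definition gf_S :: "real \<Rightarrow> real \<Rightarrow> quat fls" where
  "gf_S a b = (let f = bifib_odd_gf a b; t = fls_X; c = fls_const (of_real (a * b + 1)) in
       (f - t)
     + (f / t - 1) * fls_const quat_i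
     + (f / t ^ 2 - 1 / t - c * t) * fls_const quat_j
     + (f / t ^ 3 - 1 / t ^ 2 - c) * fls_const quat_k)"

end

theory Submission
  imports Defs
begin

unbundle fps_syntax

text \<open>
  Multiplying \<open>\<Sum>\<^sub>n Q\<^sub>n\<^sub>+\<^sub>m t\<^sup>n\<close> by \<open>1 - bt - t\<^sup>2\<close> turns every coefficient from \<open>t\<^sup>2\<close> onwards into
  the defect \<open>Q\<^sub>n\<^sub>+\<^sub>m - b Q\<^sub>n\<^sub>+\<^sub>m\<^sub>-\<^sub>1 - Q\<^sub>n\<^sub>+\<^sub>m\<^sub>-\<^sub>2\<close>. In each quaternion component the defect vanishes at odd
  Fibonacci indices, and at an even index \<open>N\<close> it equals \<open>(a - b) F\<^sub>N\<^sub>-\<^sub>1\<close>. Hence it only involves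
  odd-indexed Fibonacci numbers, and \<open>R\<close> (for \<open>m = 0\<close>) and \<open>S\<close> (for \<open>m = 1\<close>) collect these terms.
\<close>

lemma quat_of_real_simps [simp]:
  "qRe (of_real r) = r" "qIm1 (of_real r) = 0" "qIm2 (of_real r) = 0" "qIm3 (of_real r) = 0"
  by (simp_all add: of_real_def)

lemma quat_unit_simps [simp]:
  "qRe quat_i = 0" "qIm1 quat_i = 1" "qIm2 quat_i = 0" "qIm3 quat_i = 0"
  "qRe quat_j = 0" "qIm1 quat_j = 0" "qIm2 quat_j = 1" "qIm3 quat_j = 0"
  "qRe quat_k = 0" "qIm1 quat_k = 0" "qIm2 quat_k = 0" "qIm3 quat_k = 1"
  by (simp_all add: quat_i_def quat_j_def quat_k_def)

lemma bifib_3: "bifib a b 3 = a * b + 1"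
  by (simp add: numeral_3_eq_3)

text \<open>As towers of \<open>Suc\<close>, the shifted indices match the recursion equation of
  \<open>bifib\<close>.\<close>

lemma bifib_add_numeral:
  "bifib a b (n + 2) = bifib a b (Suc (Suc n))"
  "bifib a b (n + 3) = bifib a b (Suc (Suc (Suc n)))"
  "bifib a b (n + 4) = bifib a b (Suc (Suc (Suc (Suc n))))"
  "bifib a b (n + 5) = bifib a b (Suc (Suc (Suc (Suc (Suc n)))))"
  "bifib a b (n + 6) = bifib a b (Suc (Suc (Suc (Suc (Suc (Suc n))))))"
  "bifib a b (3 + n) = bifib a b (Suc (Suc (Suc n)))"
  "bifib a b (4 + n) = bifib a b (Suc (Suc (Suc (Suc n))))"
  by (simp_all add: numeral_eq_Suc del: bifib.simps)

lemma bifib_quat_simps [simp]: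
  "qRe (bifib_quat a b n) = bifib a b n"
  "qIm1 (bifib_quat a b n) = bifib a b (n + 1)"
  "qIm2 (bifib_quat a b n) = bifib a b (n + 2)"
  "qIm3 (bifib_quat a b n) = bifib a b (n + 3)"
  by (simp_all add: bifib_quat_def)

lemma bifib_odd_gf_nth:
  "bifib_odd_gf a b $$ n = (if n \<ge> 0 \<and> odd n then of_real (bifib a b (nat n)) else 0)"
  by (auto simp: bifib_odd_gf_def even_nat_iff)

text \<open>The correction terms in \<open>R\<close> and \<open>S\<close> live only at exponents -2
  to 1; from 2 on, coefficients follow a uniform pattern.\<close>

lemma int_cases_two:
  fixes n :: int
  obtains "n < -2" | "n = -2" | "n = -1" | "n = 0" | "n = 1" | m where "n = int m + 2"
proof -
  have "n = int (nat (n - 2)) + 2" if "n \<ge> 2"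
    using that by simp
  then show thesis
    using that by (cases "n \<ge> 2") (metis, force)
qed

text \<open>The subtracted terms cancel exactly the contributions of F_1 = 1 and F_3 = ab + 1 below
  \<open>t^2\<close>. Since f is odd, each component of \<open>R\<close> has exponents of one
  parity.\<close>

lemma gf_R_nth:
  "gf_R a b $$ n =
     (if n < 2 then 0
      else if even n then of_real (bifib a b (nat n - 1)) + of_real (bifib a b (nat n + 1)) * quat_j
      else of_real (bifib a b (nat n)) * quat_i + of_real (bifib a b (nat n + 2)) * quat_k)"
  by (cases n rule: int_cases_two)
     (auto simp: gf_R_def Let_def fls_X_times_conv_shift bifib_odd_gf_nth quat_eq_iff
        nat_add_distrib nat_diff_distrib bifib_3 bifib_add_numeral)

lemma gf_S_nth:
  "gf_S a b $$ n =
     (if n < 2 then 0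
      else if even n then of_real (bifib a b (nat n + 1)) * quat_i + of_real (bifib a b (nat n + 3)) * quat_k
      else of_real (bifib a b (nat n)) + of_real (bifib a b (nat n + 2)) * quat_j)"
  by (cases n rule: int_cases_two)
     (auto simp: gf_S_def Let_def fls_X_times_conv_shift bifib_odd_gf_nth quat_eq_iff
        nat_add_distrib nat_diff_distrib bifib_3 bifib_add_numeral)

lemma of_real_quat_commute: "of_real r * x = x * of_real r" for x :: quat
  by (simp add: quat_eq_iff)

text \<open>Treats both parts at once: m = 0 serves the standard part with \<open>R\<close>, m = 1
  the dual part with \<open>S\<close>.\<close>

lemma bifib_quat_gf_eq:
  fixes a b :: real and m :: nat and T :: "quat fls"
  assumes T: "\<And>n. n < 2 \<Longrightarrow> T $$ n = 0"
    and T2: "\<And>n. of_real (a - b) * T $$ (int n + 2) =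
      bifib_quat a b (n + m + 2) - of_real b * bifib_quat a b (n + m + 1) - bifib_quat a b (n + m)"
  shows "(fls_const (bifib_quat a b m)
          + fls_const (bifib_quat a b (m + 1) - of_real b * bifib_quat a b m) * fls_X
          + fls_const (of_real (a - b)) * T) / (1 - fls_const (of_real b) * fls_X - fls_X ^ 2)
       = fps_to_fls (Abs_fps (\<lambda>n. bifib_quat a b (n + m)))"
  (is "?N / ?D = ?H")
proof -
  have "?D $$ 0 = 1"
    by (simp add: fls_X_times_conv_shift)
  then have "?D \<noteq> 0"
    by (metis fls_zero_nth zero_neq_one)
  \<comment> \<open>Division is right multiplication by the inverse, so \<open>?D\<close> must stand
    on the right.\<close>
  moreover have "?N = ?H * ?D"
  proof (rule fls_eqI)
    fix n :: int
    have "?H * fls_const (of_real b) = fls_const (of_real b) * ?H"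
      by (rule fls_eqI) (simp add: of_real_quat_commute)
    then have "?H * ?D = ?H - fls_const (of_real b) * ?H * fls_X - ?H * fls_X ^ 2"
      by (simp add: right_diff_distrib flip: mult.assoc)
    then have "(?H * ?D) $$ n = ?H $$ n - of_real b * ?H $$ (n - 1) - ?H $$ (n - 2)"
      by (simp add: fls_X_power_times_conv_shift fls_X_times_conv_shift)
    then show "?N $$ n = (?H * ?D) $$ n"
      \<comment> \<open>Negative exponents give 0 on both sides, exponents 0 and 1 match the
        explicit terms of \<open>?N\<close>, and the rest is \<open>T2\<close>.\<close>
      by (cases n rule: int_cases_two)
         (simp_all add: T T2 fls_X_times_conv_shift nat_add_distrib ac_simps del: of_real_diff)
  qed
  ultimately show ?thesis
    by (simp add: fls_divide_convert_times_inverse mult.assoc)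
qed

text \<open>For even n the even Fibonacci indices sit in the real and j components, for odd n in the
  i and k components.\<close>

lemma gf_R_defect:
  "of_real (a - b) * gf_R a b $$ (int n + 2) =
     bifib_quat a b (n + 2) - of_real b * bifib_quat a b (n + 1) - bifib_quat a b n"
  by (cases "even n")
     (simp_all add: gf_R_nth quat_eq_iff nat_add_distrib bifib_add_numeral algebra_simps
        del: of_real_add of_real_mult of_real_diff)

text \<open>The index shift by one swaps the roles of the two parities.\<close>

lemma gf_S_defect:
  "of_real (a - b) * gf_S a b $$ (int n + 2) =
     bifib_quat a b (n + 3) - of_real b * bifib_quat a b (n + 2) - bifib_quat a b (n + 1)"
  by (cases "even n")
     (simp_all add: gf_S_nth quat_eq_iff nat_add_distrib bifib_add_numeral algebra_simps
        del: of_real_add of_real_mult of_real_diff)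

lemma fls_dual_of_nth [simp]: "fls_dual_of f $$ n = dual_of (f $$ n)"
  by (simp add: fls_dual_of.rep_eq)

theorem theorem3p2:
  fixes a b :: real
  assumes "a \<noteq> 0" and "b \<noteq> 0"
  shows "fps_to_fls (bifib_dual_quat_gf a b) =
      fls_dual_of
        ((fls_const (bifib_quat a b 0)
          + fls_const (bifib_quat a b 1 - of_real b * bifib_quat a b 0) * fls_X
          + fls_const (of_real (a - b)) * gf_R a b)
         / (1 - fls_const (of_real b) * fls_X - fls_X ^ 2))
    + fls_const \<epsilon> * fls_dual_of
        ((fls_const (bifib_quat a b 1)
          + fls_const (bifib_quat a b 2 - of_real b * bifib_quat a b 1) * fls_X
          + fls_const (of_real (a - b)) * gf_S a b)
         / (1 - fls_const (of_real b) * fls_X - fls_X ^ 2))"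
  (is "_ = fls_dual_of ?A + _ * fls_dual_of ?B")
proof -
  have A: "?A = fps_to_fls (Abs_fps (bifib_quat a b))"
    using bifib_quat_gf_eq[where m = 0 and T = "gf_R a b"] gf_R_defect
    by (simp add: gf_R_nth)
  have B: "?B = fps_to_fls (Abs_fps (\<lambda>n. bifib_quat a b (n + 1)))"
    using bifib_quat_gf_eq[where m = 1 and T = "gf_S a b"] gf_S_defect
    by (simp add: gf_S_nth numeral_2_eq_2 numeral_3_eq_3)
  show ?thesis
    unfolding A B
    by (rule fls_eqI)
       (simp add: bifib_dual_quat_gf_def bifib_dual_quat_def dual_eq_iff dual_of_def)
qed

end
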